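(* Let $\mathsf{com}$ be a causally-closed communication model such that $\mathrm{Exec}(\mathsf{com})\supseteq\mathrm{Exec}(\mathsf{synch})$. A global type $G$ is deadlock-free realisable in $\mathsf{com}$ if and only if the following four conditions hold: 1. $\mathrm{MSC}(\mathrm{proj}(G),\mathsf{com})\subseteq \mathrm{Pref}(\mathrm{MSC}(\mathsf{synch}))$; 2. $\mathrm{proj}(G)$ is orphan-free in $\mathsf{com}$; 3. $\mathrm{MSC}(\mathrm{proj}(G^{acc}),\mathsf{com})\subseteq\mathrm{Pref}(\mathrm{MSC}(\mathrm{proj}(G),\mathsf{com}))$; 4. $G$ is deadlock-free realisable in $\mathsf{synch}$.
   Context: Fix a finite set $P$ of processes and a finite set $\mathbb M$ of messages. Actions are send actions $p!q(m)$ (executed by $p$: $p$ sends $m$ to $q$) and receive actions $p?q(m)$ (executed by $q$: $q$ receives $m$ from $p$); $\mathrm{Act}$ is the set of actions and $\mathrm{Act}_p$ the set of actions executed by $p$. An event of a word $w\in \mathrm{Act}^*$ is a position of $w$. An execution is a pair $e=(w,\mathrm{src})$ with $w\in \mathrm{Act}^*$ and $\mathrm{src}$ an injective function from the receive events of $w$ to the send events of $w$ such that a receive event $r$ labelled $p?q(m)$ has $\mathrm{src}(r)<r$ and $\mathrm{src}(r)$ labelled $p!q(m)$. $e$ is orphan-free if $\mathrm{src}$ is surjective onto the send events. $e_1=(w_1,\mathrm{src}_1)$ is a prefix of $e_2=(w_2,\mathrm{src}_2)$ if $w_1$ is a prefix of $w_2$ and $\mathrm{src}_1$ is the restriction of $\mathrm{src}_2$.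 A communication model $\mathsf{com}$ is a set $\mathrm{Exec}(\mathsf{com})$ of executions. $\mathrm{Exec}(\mathsf{synch})$ is the set of executions in which, for every send event $s$, $s+1$ is a receive event with $\mathrm{src}(s+1)=s$. An MSC is a pair $M=((w_p)_{p\in P},\mathrm{src})$ with $w_p\in \mathrm{Act}_p^*$; its events are pairs ($p$, position in $w_p$), and $\mathrm{src}$ is an injective map from receive events to send events such that a receive event labelled $p?q(m)$ is mapped to a send event labelled $p!q(m)$. $M$ is a prefix of $M'=((w'_p)_p,\mathrm{src}')$ if each $w_p$ is a prefix of $w'_p$ and $\mathrm{src}'$ agrees with $\mathrm{src}$ on the receive events of $M$; $\mathrm{Pref}(X)$ is the set of all prefixes of elements of $X$. For an execution $e=(w,\mathrm{src})$, $\mathrm{msc}(e)$ is the MSC whose $w_p$ is the subsequence $e|_p$ of actions of $p$ in $w$, with $\mathrm{src}$ transported. The set $\mathrm{Lin}(M)$ of linearisations of $M$ is the set of executions $e$ with $\mathrm{msc}(e)=M$; $\mathrm{Lin}_{\mathsf{com}}(M)=\mathrm{Lin}(M)\cap\mathrm{Exec}(\mathsf{com})$; $\mathrm{MSC}(\mathsf{com})=\{\mathrm{msc}(e)\mid e\in\mathrm{Exec}(\mathsf{com})\}$. $\mathsf{com}$ is causally-closed if for all MSCs $M$, $\mathrm{Lin}_{\mathsf{com}}(M)\neq\emptyset$ implies $\mathrm{Lin}_{\mathsf{com}}(M)=\mathrm{Lin}(M)$. A system of CFSMs is a tuple $S=(A_p)_{p\in P}$ where $A_p$ is an NFA with $\varepsilon$-transitions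 over $\mathrm{Act}_p$. $\mathrm{Exec}(S,\mathsf{com})$ is the set of $e\in \mathrm{Exec}(\mathsf{com})$ with $e|_p\in L(A_p)$ for all $p$, and $\mathrm{MSC}(S,\mathsf{com})=\{\mathrm{msc}(e)\mid e\in \mathrm{Exec}(S,\mathsf{com})\}$. $S^{acc}$ is $S$ with all states made accepting. $S$ is orphan-free in $\mathsf{com}$ if every $e\in\mathrm{Exec}(S,\mathsf{com})$ is orphan-free. $S$ is deadlock-free in $\mathsf{com}$ if every $e\in \mathrm{Exec}(S^{acc},\mathsf{com})$ is a prefix of some $e'\in \mathrm{Exec}(S,\mathsf{com})$. An arrow is a triple $p\to q{:}m$ with $p\neq q$ in $P$, $m\in\mathbb M$; $\mathrm{Arr}$ is the finite set of arrows. A global type $G$ is a deterministic finite automaton over $\mathrm{Arr}$; $G^{acc}$ is $G$ with all states made accepting. For $w\in \mathrm{Arr}^*$, $\mathrm{msc}(w)$ is the MSC of the synchronous execution obtained by replacing each arrow $p\to q{:}m$ by $p!q(m)\cdot p?q(m)$; $\mathcal L_\exists(G)=\{\mathrm{msc}(w)\mid w\in L(G)\}$ and $\mathrm{Exec}(G,\mathsf{com})=\bigcup\{\mathrm{Lin}_{\mathsf{com}}(M)\mid M\in\mathcal L_\exists(G)\}$. The projection $\mathrm{proj}(G)=(G_p)_{p\in P}$ is the system where $G_p$ is obtained from $G$ by replacing each transition label $q\to r{:}m$ by $p!r(m)$ if $p=q$, by $q?p(m)$ if $p=r$, and by $\varepsilon$ otherwise. $G$ is deadlock-free realisable in $\mathsf{com}$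 if (CC) $\mathrm{Exec}(\mathrm{proj}(G),\mathsf{com})=\mathrm{Exec}(G,\mathsf{com})$ and (DF) $\mathrm{proj}(G)$ is deadlock-free in $\mathsf{com}$. *)

theory Defs
  imports Main "HOL-Library.Sublist"
begin

text \<open>
  Processes and messages are the elements of the types \<open>'p\<close> and \<open>'m\<close>.
  \<open>Send p q m\<close> is the action \<open>p!q(m)\<close>, executed by \<open>p\<close>, and \<open>Recv p q m\<close> is the action \<open>p?q(m)\<close>,
  executed by \<open>q\<close>: in both cases \<open>m\<close> travels from \<open>p\<close> to \<open>q\<close>.
\<close>

datatype ('p, 'm) action = Send 'p 'p 'm | Recv 'p 'p 'm

fun executor :: "('p, 'm) action \<Rightarrow> 'p" where
  "executor (Send p q m) = p"
| "executor (Recv p q m) = q"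

fun is_send :: "('p, 'm) action \<Rightarrow> bool" where
  "is_send (Send p q m) = True"
| "is_send (Recv p q m) = False"

fun is_recv :: "('p, 'm) action \<Rightarrow> bool" where
  "is_recv (Send p q m) = False"
| "is_recv (Recv p q m) = True"


section \<open>Executions\<close>

text \<open>
  Events of a word are its positions, counted from 0. A source function is a partial map whose
  domain is exactly the set of receive events, so that equality of executions is equality of pairs.
\<close>

type_synonym ('p, 'm) execution = "('p, 'm) action list \<times> (nat \<rightharpoonup> nat)"

definition send_events :: "('p, 'm) action list \<Rightarrow> nat set" where
  "send_events w = {i. i < length w \<and> is_send (w ! i)}"

definition recv_events :: "('p, 'm) action list \<Rightarrow> nat set" where
  "recv_events w = {i. i < length w \<and> is_recv (w ! i)}"

definition executions :: "('p, 'm) execution set" where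
  "executions = {(w, src).
     dom src = recv_events w \<and> ran src \<subseteq> send_events w \<and> inj_on src (dom src) \<and>
     (\<forall>r s. src r = Some s \<longrightarrow>
        s < r \<and> (\<exists>p q m. w ! r = Recv p q m \<and> w ! s = Send p q m))}"

definition orphan_free :: "('p, 'm) execution \<Rightarrow> bool" where
  "orphan_free e \<longleftrightarrow> ran (snd e) = send_events (fst e)"

definition exec_prefix :: "('p, 'm) execution \<Rightarrow> ('p, 'm) execution \<Rightarrow> bool" where
  "exec_prefix e1 e2 \<longleftrightarrow>
     prefix (fst e1) (fst e2) \<and> snd e1 = snd e2 |` recv_events (fst e1)"

text \<open>A communication model is identified with its set of executions.\<close>

definition communication_model :: "('p, 'm) execution set \<Rightarrow> bool" where
  "communication_model com \<longleftrightarrow> com \<subseteq> executions"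

definition synch :: "('p, 'm) execution set" where
  "synch = {(w, src) \<in> executions.
     \<forall>s \<in> send_events w. Suc s \<in> recv_events w \<and> src (Suc s) = Some s}"


section \<open>Message sequence charts\<close>

type_synonym ('p, 'm) msc =
  "('p \<Rightarrow> ('p, 'm) action list) \<times> ('p \<times> nat \<rightharpoonup> 'p \<times> nat)"

definition msc_send_events :: "('p \<Rightarrow> ('p, 'm) action list) \<Rightarrow> ('p \<times> nat) set" where
  "msc_send_events ws = {(p, i). i \<in> send_events (ws p)}"

definition msc_recv_events :: "('p \<Rightarrow> ('p, 'm) action list) \<Rightarrow> ('p \<times> nat) set" where
  "msc_recv_events ws = {(p, i). i \<in> recv_events (ws p)}"

text \<open>MSCs need not be acyclic: an MSC may have no linearisation.\<close>

definition mscs :: "('p, 'm) msc set" where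
  "mscs = {(ws, src).
     (\<forall>p. \<forall>a \<in> set (ws p). executor a = p) \<and>
     dom src = msc_recv_events ws \<and> ran src \<subseteq> msc_send_events ws \<and> inj_on src (dom src) \<and>
     (\<forall>p' i q' j. src (p', i) = Some (q', j) \<longrightarrow>
        (\<exists>p q m. ws p' ! i = Recv p q m \<and> ws q' ! j = Send p q m))}"

definition msc_prefix :: "('p, 'm) msc \<Rightarrow> ('p, 'm) msc \<Rightarrow> bool" where
  "msc_prefix M M' \<longleftrightarrow>
     (\<forall>p. prefix (fst M p) (fst M' p)) \<and>
     (\<forall>x \<in> msc_recv_events (fst M). snd M' x = snd M x)"

definition Pref :: "('p, 'm) msc set \<Rightarrow> ('p, 'm) msc set" where
  "Pref X = {M \<in> mscs. \<exists>M' \<in> X. msc_prefix M M'}"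

definition restrict_proc :: "('p, 'm) action list \<Rightarrow> 'p \<Rightarrow> ('p, 'm) action list" where
  "restrict_proc w p = filter (\<lambda>a. executor a = p) w"

text \<open>
  \<open>msc_event w\<close> maps each position of \<open>w\<close> to the corresponding event of the MSC: its executor \<open>p\<close>,
  together with the number of earlier actions of \<open>p\<close>. It is injective on the positions of \<open>w\<close>, and
  \<open>msc\<close> transports the source function along it.
\<close>

definition msc_event :: "('p, 'm) action list \<Rightarrow> nat \<Rightarrow> 'p \<times> nat" where
  "msc_event w i =
     (let p = executor (w ! i) in (p, length (restrict_proc (take i w) p)))"

definition msc :: "('p, 'm) execution \<Rightarrow> ('p, 'm) msc" where
  "msc e = (case e of (w, src) \<Rightarrow>
     (restrict_proc w,
      \<lambda>x. if x \<in> msc_event w ` recv_events w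
          then map_option (msc_event w) (src (inv_into (recv_events w) (msc_event w) x))
          else None))"

definition Lin :: "('p, 'm) msc \<Rightarrow> ('p, 'm) execution set" where
  "Lin M = {e \<in> executions. msc e = M}"

definition Lin_com :: "('p, 'm) execution set \<Rightarrow> ('p, 'm) msc \<Rightarrow> ('p, 'm) execution set" where
  "Lin_com com M = Lin M \<inter> com"

definition MSC_com :: "('p, 'm) execution set \<Rightarrow> ('p, 'm) msc set" where
  "MSC_com com = msc ` com"

definition causally_closed :: "('p, 'm) execution set \<Rightarrow> bool" where
  "causally_closed com \<longleftrightarrow>
     (\<forall>M \<in> mscs. Lin_com com M \<noteq> {} \<longrightarrow> Lin_com com M = Lin M)"


section \<open>Automata and systems\<close>

text \<open>The label \<open>None\<close> stands for \<open>\<epsilon>\<close>.\<close>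

record ('s, 'a) nfa =
  states :: "'s set"
  initial :: 's
  transitions :: "('s \<times> 'a option \<times> 's) set"
  accepting :: "'s set"

definition nfa_over :: "'a set \<Rightarrow> ('s, 'a) nfa \<Rightarrow> bool" where
  "nfa_over \<Sigma> A \<longleftrightarrow>
     finite (states A) \<and> initial A \<in> states A \<and> accepting A \<subseteq> states A \<and>
     transitions A \<subseteq> states A \<times> insert None (Some ` \<Sigma>) \<times> states A"

text \<open>Determinism is meant in the partial sense: a letter may have no transition from a state.\<close>

definition dfa_over :: "'a set \<Rightarrow> ('s, 'a) nfa \<Rightarrow> bool" where
  "dfa_over \<Sigma> A \<longleftrightarrow>
     nfa_over \<Sigma> A \<and>
     (\<forall>s t. (s, None, t) \<notin> transitions A) \<and>
     (\<forall>s a t t'. (s, a, t) \<in> transitions A \<and> (s, a, t') \<in> transitions A \<longrightarrow> t = t')"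

inductive run :: "('s, 'a) nfa \<Rightarrow> 's \<Rightarrow> 'a list \<Rightarrow> 's \<Rightarrow> bool" for A where
  run_Nil: "run A s [] s"
| run_eps: "(s, None, t) \<in> transitions A \<Longrightarrow> run A t w u \<Longrightarrow> run A s w u"
| run_Cons: "(s, Some a, t) \<in> transitions A \<Longrightarrow> run A t w u \<Longrightarrow> run A s (a # w) u"

definition language :: "('s, 'a) nfa \<Rightarrow> 'a list set" where
  "language A = {w. \<exists>t \<in> accepting A. run A (initial A) w t}"

definition all_accepting :: "('s, 'a) nfa \<Rightarrow> ('s, 'a) nfa" where
  "all_accepting A = A\<lparr>accepting := states A\<rparr>"

type_synonym ('s, 'p, 'm) system = "'p \<Rightarrow> ('s, ('p, 'm) action) nfa"

definition is_system :: "('s, 'p, 'm) system \<Rightarrow> bool" where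
  "is_system S \<longleftrightarrow> (\<forall>p. nfa_over {a. executor a = p} (S p))"

definition system_acc :: "('s, 'p, 'm) system \<Rightarrow> ('s, 'p, 'm) system" where
  "system_acc S = (\<lambda>p. all_accepting (S p))"

definition Exec_sys ::
  "('s, 'p, 'm) system \<Rightarrow> ('p, 'm) execution set \<Rightarrow> ('p, 'm) execution set" where
  "Exec_sys S com = {e \<in> com. \<forall>p. restrict_proc (fst e) p \<in> language (S p)}"

definition MSC_sys ::
  "('s, 'p, 'm) system \<Rightarrow> ('p, 'm) execution set \<Rightarrow> ('p, 'm) msc set" where
  "MSC_sys S com = msc ` Exec_sys S com"

definition orphan_free_in :: "('s, 'p, 'm) system \<Rightarrow> ('p, 'm) execution set \<Rightarrow> bool" where
  "orphan_free_in S com \<longleftrightarrow> (\<forall>e \<in> Exec_sys S com. orphan_free e)"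

definition deadlock_free_in :: "('s, 'p, 'm) system \<Rightarrow> ('p, 'm) execution set \<Rightarrow> bool" where
  "deadlock_free_in S com \<longleftrightarrow>
     (\<forall>e \<in> Exec_sys (system_acc S) com. \<exists>e' \<in> Exec_sys S com. exec_prefix e e')"


section \<open>Global types\<close>

text \<open>\<open>(p, q, m)\<close> is the arrow \<open>p \<rightarrow> q:m\<close>, provided that it is in \<open>Arr\<close>.\<close>

type_synonym ('p, 'm) arrow = "'p \<times> 'p \<times> 'm"

definition Arr :: "('p, 'm) arrow set" where
  "Arr = {(p, q, m). p \<noteq> q}"

definition global_type :: "('s, ('p, 'm) arrow) nfa \<Rightarrow> bool" where
  "global_type G \<longleftrightarrow> dfa_over Arr G"

definition arrows_exec :: "('p, 'm) arrow list \<Rightarrow> ('p, 'm) execution" where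
  "arrows_exec w =
     (concat (map (\<lambda>(p, q, m). [Send p q m, Recv p q m]) w),
      \<lambda>i. if i < 2 * length w \<and> odd i then Some (i - 1) else None)"

definition arrows_msc :: "('p, 'm) arrow list \<Rightarrow> ('p, 'm) msc" where
  "arrows_msc w = msc (arrows_exec w)"

definition L_exists :: "('s, ('p, 'm) arrow) nfa \<Rightarrow> ('p, 'm) msc set" where
  "L_exists G = arrows_msc ` language G"

definition Exec_gt ::
  "('s, ('p, 'm) arrow) nfa \<Rightarrow> ('p, 'm) execution set \<Rightarrow> ('p, 'm) execution set" where
  "Exec_gt G com = (\<Union>M \<in> L_exists G. Lin_com com M)"

fun proj_arrow :: "'p \<Rightarrow> ('p, 'm) arrow \<Rightarrow> ('p, 'm) action option" where
  "proj_arrow p (q, r, m) =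
     (if p = q then Some (Send p r m) else if p = r then Some (Recv q p m) else None)"

definition proj :: "('s, ('p, 'm) arrow) nfa \<Rightarrow> ('s, 'p, 'm) system" where
  "proj G = (\<lambda>p.
     \<lparr>states = states G,
      initial = initial G,
      transitions = {(s, proj_arrow p x, t) | s x t. (s, Some x, t) \<in> transitions G},
      accepting = accepting G\<rparr>)"

lemma is_system_proj:
  fixes G :: "('s, ('p, 'm) arrow) nfa"
  shows "global_type G \<Longrightarrow> is_system (proj G)"
  unfolding global_type_def dfa_over_def nfa_over_def is_system_def
proof (intro allI conjI; elim conjE)
  fix p :: 'p
  assume tr: "transitions G \<subseteq> states G \<times> insert None (Some ` Arr) \<times> states G"
  have "proj_arrow p x \<in> insert None (Some ` {a. executor a = p})" for x :: "('p, 'm) arrow"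
    by (cases x) auto
  then show "transitions (proj G p) \<subseteq>
      states (proj G p) \<times> insert None (Some ` {a. executor a = p}) \<times> states (proj G p)"
    using tr unfolding proj_def nfa.simps by (intro subsetI) (elim CollectE exE conjE; simp; blast)
qed (simp_all add: proj_def)

text \<open>The two conjuncts are (CC) and (DF).\<close>

definition deadlock_free_realisable ::
  "('s, ('p, 'm) arrow) nfa \<Rightarrow> ('p, 'm) execution set \<Rightarrow> bool" where
  "deadlock_free_realisable G com \<longleftrightarrow>
     Exec_sys (proj G) com = Exec_gt G com \<and> deadlock_free_in (proj G) com"

end

theory Submission
  imports Defs
begin

text \<open>
  An execution is the same thing as the list of the events of its MSC in the order of execution:
  every process numbers its events consecutively, and each receive comes after its source. Two
  surgeries on such lists carry the proof. If the MSC of \<open>e\<close> is a prefix of that of \<open>e'\<close>, then \<open>e\<close>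
  followed by the events of \<open>e'\<close> missing from it is a linearisation of the MSC of \<open>e'\<close>; causal closure
  keeps it in \<open>com\<close>, and it is synchronous if \<open>e\<close> and \<open>e'\<close> are. If the MSC of an orphan-free \<open>e\<close> is a
  prefix of that of a synchronous \<open>e'\<close>, then deleting from \<open>e'\<close> the events not in \<open>e\<close> removes matching
  pairs only, so the MSC of \<open>e\<close> has a synchronous linearisation.
\<close>

section \<open>Event lists\<close>

text \<open>Only the order of the events is kept. The actions are stored in the MSC and come back
  through \<open>label\<close>, by \<open>map_label_msc_events\<close>.\<close>

definition msc_events :: "('p, 'm) action list \<Rightarrow> ('p \<times> nat) list" where
  "msc_events w = map (msc_event w) [0..<length w]"

text \<open>These are exactly the lists \<open>msc_events w\<close> for words \<open>w\<close>:
  \<open>numbered_msc_events\<close> gives one direction, \<open>msc_events_map\<close> the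
  other.\<close>

definition numbered :: "('p \<times> nat) list \<Rightarrow> bool" where
  "numbered xs \<longleftrightarrow>
     (\<forall>p. map snd (filter (\<lambda>x. fst x = p) xs) = [0..<length (filter (\<lambda>x. fst x = p) xs)])"

lemma numbered_Nil [simp]: "numbered []"
  by (simp add: numbered_def)

lemma numbered_snoc:
  "numbered (xs @ [x]) \<longleftrightarrow>
     numbered xs \<and> snd x = length (filter (\<lambda>y. fst y = fst x) xs)"
  unfolding numbered_def by auto

lemma numbered_set:
  assumes "numbered xs"
  shows "(p, i) \<in> set xs \<longleftrightarrow> i < length (filter (\<lambda>x. fst x = p) xs)"
proof -
  have "(p, i) \<in> set xs \<longleftrightarrow> i \<in> set (map snd (filter (\<lambda>x. fst x = p) xs))"
    by force
  then show ?thesis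
    using assms unfolding numbered_def by simp
qed

lemma numbered_distinct: "numbered xs \<Longrightarrow> distinct xs"
proof (induction xs rule: rev_induct)
  case (snoc x xs)
  then show ?case
    using numbered_set[of xs "fst x" "snd x"] by (cases x) (simp add: numbered_snoc)
qed simp

lemma msc_event_append: "i < length w \<Longrightarrow> msc_event (w @ v) i = msc_event w i"
  by (simp add: msc_event_def nth_append Let_def)

lemma msc_events_Nil [simp]: "msc_events [] = []"
  by (simp add: msc_events_def)

lemma msc_events_snoc:
  "msc_events (w @ [a]) = msc_events w @ [(executor a, length (restrict_proc w (executor a)))]"
proof -
  have "msc_event (w @ [a]) (length w) = (executor a, length (restrict_proc w (executor a)))"
    by (simp add: msc_event_def Let_def)
  then show ?thesis
    by (simp add: msc_events_def msc_event_append)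
qed

lemma length_msc_events [simp]: "length (msc_events w) = length w"
  by (simp add: msc_events_def)

lemma nth_msc_events [simp]: "i < length w \<Longrightarrow> msc_events w ! i = msc_event w i"
  by (simp add: msc_events_def)

lemma set_msc_events: "set (msc_events w) = msc_event w ` {..<length w}"
  by (auto simp: msc_events_def)

lemma length_filter_msc_events:
  "length (filter (\<lambda>x. fst x = p) (msc_events w)) = length (restrict_proc w p)"
  by (induction w rule: rev_induct) (auto simp: msc_events_snoc restrict_proc_def)

lemma numbered_msc_events: "numbered (msc_events w)"
  by (induction w rule: rev_induct)
    (auto simp: msc_events_snoc numbered_snoc length_filter_msc_events)

lemma in_set_msc_events: "(p, i) \<in> set (msc_events w) \<longleftrightarrow> i < length (restrict_proc w p)"
  using numbered_set[OF numbered_msc_events] by (simp add: length_filter_msc_events)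

lemma inj_on_msc_event: "inj_on (msc_event w) {..<length w}"
  using numbered_distinct[OF numbered_msc_events, of w]
  by (simp add: msc_events_def distinct_map atLeast0LessThan)

lemma msc_event_eq_iff:
  "i < length w \<Longrightarrow> j < length w \<Longrightarrow> msc_event w i = msc_event w j \<longleftrightarrow> i = j"
  using inj_on_msc_event[of w] by (auto simp: inj_on_def)

section \<open>Labels of events\<close>

definition label :: "('p \<Rightarrow> ('p, 'm) action list) \<Rightarrow> 'p \<times> nat \<Rightarrow> ('p, 'm) action" where
  "label ws x = ws (fst x) ! snd x"

text \<open>An appended action becomes the last one of its own process, so no earlier label changes.
  A word is thus determined by its MSC together with its event list.\<close>

lemma map_label_msc_events: "map (label (restrict_proc w)) (msc_events w) = w"
proof (induction w rule: rev_induct)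
  case (snoc a w)
  have "label (restrict_proc (w @ [a])) x = label (restrict_proc w) x"
    if "x \<in> set (msc_events w)" for x
    using that in_set_msc_events[of "fst x" "snd x" w]
    by (auto simp: label_def restrict_proc_def nth_append)
  then have "map (label (restrict_proc (w @ [a]))) (msc_events w)
      = map (label (restrict_proc w)) (msc_events w)"
    by simp
  with snoc have "map (label (restrict_proc (w @ [a]))) (msc_events w) = w"
    by simp
  moreover have "label (restrict_proc (w @ [a])) (executor a, length (restrict_proc w (executor a))) = a"
    by (simp add: label_def restrict_proc_def)
  ultimately show ?case
    by (simp add: msc_events_snoc)
qed simp

lemma label_msc_event: "i < length w \<Longrightarrow> label (restrict_proc w) (msc_event w i) = w ! i"
  using map_label_msc_events[of w] by (metis length_msc_events nth_map nth_msc_events)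

text \<open>The second component of an event counts the earlier events of its process, so only the
  executors of the labels matter, not the labels themselves.\<close>

lemma msc_events_map:
  assumes "numbered xs" and "\<And>x. x \<in> set xs \<Longrightarrow> executor (g x) = fst x"
  shows "msc_events (map g xs) = xs"
  using assms
proof (induction xs rule: rev_induct)
  case (snoc x xs)
  have "length (restrict_proc (map g xs) (fst x)) = length (filter (\<lambda>y. fst y = fst x) xs)"
    using snoc.prems(2) unfolding restrict_proc_def filter_map length_map
    by (intro arg_cong[where f = length] filter_cong) auto
  with snoc show ?case
    by (simp add: msc_events_snoc numbered_snoc prod_eq_iff)
qed simp

lemma msc_send_events_iff:
  "x \<in> msc_send_events ws \<longleftrightarrow> snd x < length (ws (fst x)) \<and> is_send (label ws x)"
  by (cases x) (simp add: msc_send_events_def send_events_def label_def)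

lemma msc_recv_events_iff:
  "x \<in> msc_recv_events ws \<longleftrightarrow> snd x < length (ws (fst x)) \<and> is_recv (label ws x)"
  by (cases x) (simp add: msc_recv_events_def recv_events_def label_def)

lemma label_prefix:
  assumes "prefix (ws (fst x)) (ws' (fst x))" and "snd x < length (ws (fst x))"
  shows "label ws' x = label ws x"
  using assms by (auto simp: label_def prefix_def nth_append)

lemma in_msc_send_events:
  "i < length w \<Longrightarrow> msc_event w i \<in> msc_send_events (restrict_proc w) \<longleftrightarrow> i \<in> send_events w"
  using in_set_msc_events[of "fst (msc_event w i)" "snd (msc_event w i)" w]
  by (auto simp: msc_send_events_iff label_msc_event send_events_def set_msc_events)

lemma in_msc_recv_events:
  "i < length w \<Longrightarrow> msc_event w i \<in> msc_recv_events (restrict_proc w) \<longleftrightarrow> i \<in> recv_events w"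
  using in_set_msc_events[of "fst (msc_event w i)" "snd (msc_event w i)" w]
  by (auto simp: msc_recv_events_iff label_msc_event recv_events_def set_msc_events)

section \<open>The MSC of an execution\<close>

lemma fst_msc [simp]: "fst (msc (w, src)) = restrict_proc w"
  by (simp add: msc_def)

text \<open>Injectivity of \<open>msc_event\<close> on positions makes \<open>inv_into\<close>
  return the position \<open>r\<close> itself. At a position that is not a receive both sides are
  \<open>None\<close>.\<close>

lemma snd_msc:
  assumes "(w, src) \<in> executions" and "r < length w"
  shows "snd (msc (w, src)) (msc_event w r) = map_option (msc_event w) (src r)"
proof -
  have dom: "dom src = recv_events w"
    using assms(1) by (simp add: executions_def)
  have sub: "recv_events w \<subseteq> {..<length w}"
    by (auto simp: recv_events_def)
  have mem: "msc_event w r \<in> msc_event w ` recv_events w \<longleftrightarrow> r \<in> recv_events w"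
    using inj_on_image_mem_iff[OF inj_on_msc_event _ sub] assms(2) by auto
  have "inv_into (recv_events w) (msc_event w) (msc_event w r) = r" if "r \<in> recv_events w"
    using that inj_on_subset[OF inj_on_msc_event sub] by simp
  moreover have "src r = None" if "r \<notin> recv_events w"
    using that dom by auto
  ultimately show ?thesis
    using mem by (auto simp: msc_def)
qed

lemma snd_msc_outside:
  assumes "x \<notin> set (msc_events w)"
  shows "snd (msc (w, src)) x = None"
  using assms by (auto simp: msc_def set_msc_events recv_events_def)

lemma snd_msc_eq_Some:
  assumes "(w, src) \<in> executions" and "snd (msc (w, src)) x = Some y"
  obtains r s where "r < length w" "s < r" "src r = Some s" "x = msc_event w r" "y = msc_event w s"
    "r \<in> recv_events w" "s \<in> send_events w" "\<exists>p q m. w ! r = Recv p q m \<and> w ! s = Send p q m"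
proof -
  have "x \<in> set (msc_events w)"
    using assms(2) snd_msc_outside by fastforce
  then obtain r where r: "r < length w" "x = msc_event w r"
    by (auto simp: set_msc_events)
  then obtain s where s: "src r = Some s" "y = msc_event w s"
    using assms snd_msc by fastforce
  have "s < r" "\<exists>p q m. w ! r = Recv p q m \<and> w ! s = Send p q m" "r \<in> recv_events w"
    "s \<in> send_events w"
    using assms(1) s(1) by (auto simp: executions_def dom_def ran_def)
  with r s show thesis
    using that by blast
qed

lemma msc_in_mscs:
  assumes "(w, src) \<in> executions"
  shows "msc (w, src) \<in> mscs"
proof -
  let ?ws = "restrict_proc w" and ?f = "snd (msc (w, src))"
  have ex: "dom src = recv_events w" "inj_on src (dom src)"
    using assms by (auto simp: executions_def)
  have "dom ?f = msc_recv_events ?ws"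
  proof (intro equalityI subsetI)
    fix x assume "x \<in> dom ?f"
    then obtain y where "?f x = Some y"
      by blast
    then show "x \<in> msc_recv_events ?ws"
      by (rule snd_msc_eq_Some[OF assms]) (simp add: in_msc_recv_events)
  next
    fix x assume x: "x \<in> msc_recv_events ?ws"
    then have "x \<in> set (msc_events w)"
      using in_set_msc_events[of "fst x" "snd x" w] by (simp add: msc_recv_events_iff)
    then obtain r where r: "r < length w" "x = msc_event w r"
      by (auto simp: set_msc_events)
    with x have "r \<in> dom src"
      by (simp add: in_msc_recv_events ex)
    with r show "x \<in> dom ?f"
      using snd_msc[OF assms] by auto
  qed
  moreover have "ran ?f \<subseteq> msc_send_events ?ws"
  proof
    fix y assume "y \<in> ran ?f"
    then obtain x where "?f x = Some y"
      by (auto simp: ran_def)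
    then show "y \<in> msc_send_events ?ws"
      by (rule snd_msc_eq_Some[OF assms]) (simp add: in_msc_send_events)
  qed
  moreover have "inj_on ?f (dom ?f)"
  proof (rule inj_onI)
    fix x x' assume "x \<in> dom ?f" and eq: "?f x = ?f x'"
    then obtain y where y: "?f x = Some y"
      by blast
    with eq have y': "?f x' = Some y"
      by simp
    from y show "x = x'"
    proof (rule snd_msc_eq_Some[OF assms])
      fix r s assume *: "r < length w" "s < r" "src r = Some s" "x = msc_event w r"
        "y = msc_event w s"
      from y' show ?thesis
      proof (rule snd_msc_eq_Some[OF assms])
        fix r' s' assume **: "r' < length w" "s' < r'" "src r' = Some s'" "x' = msc_event w r'"
          "y = msc_event w s'"
        \<comment> \<open>Both sends lie before a receive, hence inside \<open>w\<close>, where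
          \<open>msc_event\<close> is injective.\<close>
        then have "s = s'"
          using * msc_event_eq_iff[of s w s'] by simp
        then have "r = r'"
          using ex(2) *(3) **(3) by (auto simp: inj_on_def dom_def)
        then show "x = x'"
          using * ** by simp
      qed
    qed
  qed
  moreover have "\<exists>p q m. label ?ws x = Recv p q m \<and> label ?ws y = Send p q m"
    if "?f x = Some y" for x y
    using that by (rule snd_msc_eq_Some[OF assms]) (simp add: label_msc_event)
  then have "\<forall>p' i q' j. ?f (p', i) = Some (q', j) \<longrightarrow>
      (\<exists>p q m. ?ws p' ! i = Recv p q m \<and> ?ws q' ! j = Send p q m)"
    by (fastforce simp: label_def)
  moreover have "\<forall>p. \<forall>a \<in> set (?ws p). executor a = p"
    by (simp add: restrict_proc_def)
  ultimately have "(?ws, ?f) \<in> mscs"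
    unfolding mscs_def by blast
  then show ?thesis
    by (metis fst_msc prod.collapse)
qed

text \<open>Both source maps are defined at receive events only, and all of these come from
  positions of \<open>w\<close>.\<close>

lemma msc_eqI:
  assumes "(w, src) \<in> executions" and "(ws, f) \<in> mscs"
    and "restrict_proc w = ws"
    and "\<And>r. r < length w \<Longrightarrow> f (msc_event w r) = map_option (msc_event w) (src r)"
  shows "msc (w, src) = (ws, f)"
proof -
  have "snd (msc (w, src)) x = f x" for x
  proof (cases "x \<in> set (msc_events w)")
    case True
    then show ?thesis
      using assms by (auto simp: set_msc_events snd_msc)
  next
    case False
    have "f x = None"
    proof (rule ccontr)
      assume "f x \<noteq> None"
      then have "x \<in> msc_recv_events ws"
        using assms(2) by (auto simp: mscs_def)
      then show False
        using False in_set_msc_events[of "fst x" "snd x" w] assms(3)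
        by (simp add: msc_recv_events_iff)
    qed
    then show ?thesis
      using False by (simp add: snd_msc_outside)
  qed
  then show ?thesis
    using assms(3) by (simp add: prod_eq_iff fun_eq_iff)
qed

text \<open>Since \<open>w\<close> is a prefix of \<open>w'\<close>, a position of \<open>w\<close>
  names the same event in both words. Agreement of sources as events then amounts to agreement as
  positions.\<close>

lemma exec_prefix_iff_msc_prefix:
  assumes "(w, src) \<in> executions" and "(w', src') \<in> executions" and "prefix w w'"
  shows "exec_prefix (w, src) (w', src') \<longleftrightarrow> msc_prefix (msc (w, src)) (msc (w', src'))"
proof -
  obtain v where w': "w' = w @ v"
    using assms(3) by (auto simp: prefix_def)
  have dom: "dom src = recv_events w" and dom': "dom src' = recv_events w'"
    using assms by (auto simp: executions_def)
  have less: "s < r" if "src' r = Some s" for r s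
    using that assms(2) by (auto simp: executions_def)
  have less0: "s < r" if "src r = Some s" for r s
    using that assms(1) by (auto simp: executions_def)
  have ev: "msc_event w' i = msc_event w i" if "i < length w" for i
    using that by (simp add: w' msc_event_append)
  have key: "snd (msc (w', src')) (msc_event w r) = snd (msc (w, src)) (msc_event w r)
      \<longleftrightarrow> src' r = src r" if r: "r < length w" for r
  proof -
    have "snd (msc (w', src')) (msc_event w r) = map_option (msc_event w') (src' r)"
      using snd_msc[OF assms(2), of r] r ev by (simp add: w')
    \<comment> \<open>A source precedes its receive, so it too lies inside \<open>w\<close>, where
      the two numberings agree.\<close>
    also have "\<dots> = map_option (msc_event w) (src' r)"
      using less[of r] r by (cases "src' r") (auto simp: ev)
    finally have "snd (msc (w', src')) (msc_event w r) = map_option (msc_event w) (src' r)" .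
    moreover have "map_option (msc_event w) (src' r) = map_option (msc_event w) (src r)
        \<longleftrightarrow> src' r = src r"
      using less[of r] less0[of r] r
      by (cases "src' r"; cases "src r") (auto simp: msc_event_eq_iff)
    ultimately show ?thesis
      using snd_msc[OF assms(1) r] by simp
  qed
  have recv: "x \<in> msc_recv_events (restrict_proc w) \<longleftrightarrow> (\<exists>r \<in> recv_events w. x = msc_event w r)"
    for x
  proof
    assume x: "x \<in> msc_recv_events (restrict_proc w)"
    then have "x \<in> set (msc_events w)"
      using in_set_msc_events[of "fst x" "snd x" w] by (simp add: msc_recv_events_iff)
    with x show "\<exists>r \<in> recv_events w. x = msc_event w r"
      by (auto simp: set_msc_events in_msc_recv_events)
  next
    assume "\<exists>r \<in> recv_events w. x = msc_event w r"
    then show "x \<in> msc_recv_events (restrict_proc w)"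
      by (auto simp: in_msc_recv_events recv_events_def)
  qed
  have "msc_prefix (msc (w, src)) (msc (w', src')) \<longleftrightarrow> (\<forall>r \<in> recv_events w. src' r = src r)"
  proof -
    have "\<forall>p. prefix (restrict_proc w p) (restrict_proc w' p)"
      by (simp add: w' restrict_proc_def)
    then have "msc_prefix (msc (w, src)) (msc (w', src')) \<longleftrightarrow>
        (\<forall>r \<in> recv_events w. snd (msc (w', src')) (msc_event w r) = snd (msc (w, src)) (msc_event w r))"
      unfolding msc_prefix_def Ball_def recv fst_msc by blast
    also have "\<dots> \<longleftrightarrow> (\<forall>r \<in> recv_events w. src' r = src r)"
      by (intro ball_cong refl key) (simp add: recv_events_def)
    finally show ?thesis .
  qed
  also have "\<dots> \<longleftrightarrow> src = src' |` recv_events w"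
  proof
    assume *: "\<forall>r \<in> recv_events w. src' r = src r"
    show "src = src' |` recv_events w"
    proof
      fix r show "src r = (src' |` recv_events w) r"
        using * dom by (cases "r \<in> recv_events w") (auto simp: restrict_map_def)
    qed
  qed auto
  finally show ?thesis
    using assms(3) by (simp add: exec_prefix_def)
qed

text \<open>Makes orphan-freedom a property of the MSC, so that it passes between executions with
  the same MSC.\<close>

lemma orphan_free_iff_msc:
  assumes "(w, src) \<in> executions"
  shows "orphan_free (w, src) \<longleftrightarrow>
    msc_send_events (restrict_proc w) \<subseteq> ran (snd (msc (w, src)))"
proof
  assume *: "orphan_free (w, src)"
  show "msc_send_events (restrict_proc w) \<subseteq> ran (snd (msc (w, src)))"
  proof
    fix x assume x: "x \<in> msc_send_events (restrict_proc w)"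
    then have "x \<in> set (msc_events w)"
      using in_set_msc_events[of "fst x" "snd x" w] by (simp add: msc_send_events_iff)
    with x obtain s where s: "s \<in> send_events w" "x = msc_event w s"
      by (auto simp: set_msc_events in_msc_send_events)
    with * obtain r where r: "src r = Some s"
      by (auto simp: orphan_free_def ran_def)
    then have "r < length w"
      using assms by (auto simp: executions_def recv_events_def dom_def)
    then have "snd (msc (w, src)) (msc_event w r) = Some x"
      using snd_msc[OF assms] r s by simp
    then show "x \<in> ran (snd (msc (w, src)))"
      by (rule ranI)
  qed
next
  assume *: "msc_send_events (restrict_proc w) \<subseteq> ran (snd (msc (w, src)))"
  have "s \<in> ran src" if s: "s \<in> send_events w" for s
  proof -
    have len: "s < length w"
      using s by (simp add: send_events_def)
    then have "msc_event w s \<in> ran (snd (msc (w, src)))"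
      using s * in_msc_send_events by blast
    then obtain x where "snd (msc (w, src)) x = Some (msc_event w s)"
      by (auto simp: ran_def)
    then show ?thesis
      by (rule snd_msc_eq_Some[OF assms]) (use len in \<open>auto simp: msc_event_eq_iff ran_def\<close>)
  qed
  then show "orphan_free (w, src)"
    using assms by (auto simp: orphan_free_def executions_def)
qed

section \<open>Linearisations as event lists\<close>

text \<open>The condition that a source precedes its receive, stated by membership instead of
  positions, so that it is easy to follow through deletions and insertions.\<close>

definition causal :: "('a \<rightharpoonup> 'a) \<Rightarrow> 'a list \<Rightarrow> bool" where
  "causal f xs \<longleftrightarrow> (\<forall>j < length xs. \<forall>y. f (xs ! j) = Some y \<longrightarrow> y \<in> set (take j xs))"

text \<open>\<open>A\<close> plays the role of the send events and \<open>f\<close> that of the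
  source map. The recursive form suits induction; \<open>synched_iff\<close> gives the form with
  positions.\<close>

fun synched :: "('a \<rightharpoonup> 'a) \<Rightarrow> 'a set \<Rightarrow> 'a list \<Rightarrow> bool" where
  "synched f A [] \<longleftrightarrow> True"
| "synched f A (x # xs) \<longleftrightarrow>
     (x \<in> A \<longrightarrow> (\<exists>y ys. xs = y # ys \<and> f y = Some x)) \<and> synched f A xs"

text \<open>Each element of \<open>A\<close> in \<open>xs\<close> already has its receive inside
  \<open>xs\<close>, so nothing depends on how \<open>ys\<close> begins.\<close>

lemma synched_append: "synched f A xs \<Longrightarrow> synched f A ys \<Longrightarrow> synched f A (xs @ ys)"
  by (induction xs) auto

text \<open>The partner of a kept element of \<open>A\<close> stands right behind it and is kept as
  well, so the two stay adjacent.\<close>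

lemma synched_filter:
  assumes "synched f A xs"
    and "\<And>x. x \<in> B \<Longrightarrow> P x \<Longrightarrow> x \<in> A"
    and "\<And>x y. P x \<Longrightarrow> x \<in> A \<Longrightarrow> f y = Some x \<Longrightarrow> P y \<and> g y = Some x"
  shows "synched g B (filter P xs)"
  using assms(1)
proof (induction xs)
  case (Cons x xs)
  then show ?case
    using assms(2,3) by fastforce
qed simp

lemma synched_iff:
  "synched f A xs \<longleftrightarrow>
     (\<forall>i < length xs. xs ! i \<in> A \<longrightarrow> Suc i < length xs \<and> f (xs ! Suc i) = Some (xs ! i))"
proof (induction xs)
  case (Cons x xs)
  then show ?case
    by (cases xs) (auto simp: All_less_Suc2)
qed simp

lemma causal_snoc: "causal f (xs @ [x]) \<longleftrightarrow> causal f xs \<and> (\<forall>y. f x = Some y \<longrightarrow> y \<in> set xs)"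
  by (auto simp: causal_def All_less_Suc nth_append)

text \<open>The source of a kept element is kept too, and deletion does not change the order of what
  remains.\<close>

lemma causal_filter:
  assumes "causal f xs"
    and "\<And>x y. P x \<Longrightarrow> g x = Some y \<Longrightarrow> f x = Some y \<and> P y"
  shows "causal g (filter P xs)"
  using assms(1)
proof (induction xs rule: rev_induct)
  case Nil
  then show ?case
    by (simp add: causal_def)
next
  case (snoc x xs)
  then show ?case
    using assms(2) by (auto simp: causal_snoc)
qed

text \<open>A source needed by an element of \<open>ys\<close> is either kept by the filter or
  already present in \<open>xs\<close>; in both cases it comes earlier.\<close>

lemma causal_append_filter:
  assumes "causal f xs" and "causal f ys"
  shows "causal f (xs @ filter (\<lambda>y. y \<notin> set xs) ys)"
  using assms(2)
proof (induction ys rule: rev_induct)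
  case (snoc y ys)
  then show ?case
    using causal_snoc[of f "xs @ filter (\<lambda>y. y \<notin> set xs) ys" y] by (auto simp: causal_snoc)
qed (simp add: assms(1))

lemma causal_msc_events:
  assumes "(w, src) \<in> executions"
  shows "causal (snd (msc (w, src))) (msc_events w)"
  unfolding causal_def length_msc_events
proof (intro allI impI)
  fix j y assume j: "j < length w" and y: "snd (msc (w, src)) (msc_events w ! j) = Some y"
  from y show "y \<in> set (take j (msc_events w))"
  proof (rule snd_msc_eq_Some[OF assms])
    fix r s assume *: "r < length w" "s < r" "msc_events w ! j = msc_event w r" "y = msc_event w s"
    then have "j = r"
      using j by (simp add: msc_event_eq_iff)
    then show ?thesis
      using * by (auto simp: msc_events_def take_map)
  qed
qed

text \<open>Synchrony becomes a property of the MSC together with the event list, which is what the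
  surgeries act on.\<close>

lemma synch_iff_synched:
  assumes "(w, src) \<in> executions"
  shows "(w, src) \<in> synch \<longleftrightarrow>
    synched (snd (msc (w, src))) (msc_send_events (restrict_proc w)) (msc_events w)"
proof -
  have less: "s < r \<and> r \<in> recv_events w \<and> r < length w" if "src r = Some s" for r s
    using that assms by (auto simp: executions_def dom_def recv_events_def)
  have key: "snd (msc (w, src)) (msc_event w (Suc i)) = Some (msc_event w i) \<longleftrightarrow> src (Suc i) = Some i"
    if "Suc i < length w" for i
    unfolding snd_msc[OF assms that]
    using that less[of "Suc i"] by (cases "src (Suc i)") (auto simp: msc_event_eq_iff)
  have "(w, src) \<in> synch \<longleftrightarrow>
      (\<forall>i < length w. i \<in> send_events w \<longrightarrow> Suc i < length w \<and> src (Suc i) = Some i)"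
    using assms less unfolding synch_def by (auto simp: send_events_def)
  also have "\<dots> \<longleftrightarrow>
      synched (snd (msc (w, src))) (msc_send_events (restrict_proc w)) (msc_events w)"
    using key by (auto simp: synched_iff in_msc_send_events)
  finally show ?thesis .
qed

text \<open>Converse of reading off \<open>msc_events\<close>: such a list is a linearisation of the
  given MSC. An element of \<open>mscs\<close> may be cyclic, and \<open>causal\<close> is what
  places each source before its receive.\<close>

lemma realise_event_list:
  assumes M: "(ws, f) \<in> mscs"
    and num: "numbered xs"
    and len: "\<And>p. length (filter (\<lambda>x. fst x = p) xs) = length (ws p)"
    and causal: "causal f xs"
  obtains src where "(map (label ws) xs, src) \<in> executions" "msc (map (label ws) xs, src) = (ws, f)"
    "msc_events (map (label ws) xs) = xs"
proof -
  let ?w = "map (label ws) xs" and ?n = "length xs"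
  have set_xs: "x \<in> set xs \<longleftrightarrow> snd x < length (ws (fst x))" for x
    using numbered_set[OF num, of "fst x" "snd x"] len by simp
  have exec_of: "executor a = p" if "a \<in> set (ws p)" for a p
    using M that by (auto simp: mscs_def)
  have "executor (label ws x) = fst x" if "x \<in> set xs" for x
    using that exec_of by (auto simp: set_xs label_def)
  then have events: "msc_events ?w = xs"
    by (rule msc_events_map[OF num])
  then have ev: "msc_event ?w i = xs ! i" if "i < ?n" for i
    using that nth_msc_events[of i ?w] by simp
  have f: "x \<in> set xs \<and> y \<in> set xs \<and> (\<exists>p q m. label ws x = Recv p q m \<and> label ws y = Send p q m)"
    if "f x = Some y" for x y
  proof -
    have "x \<in> msc_recv_events ws" "y \<in> msc_send_events ws"
      using M domI[of f, OF that] ranI[of f, OF that] by (auto simp: mscs_def)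
    moreover have "\<exists>p q m. label ws x = Recv p q m \<and> label ws y = Send p q m"
      using M that by (cases x; cases y) (fastforce simp: mscs_def label_def)
    ultimately show ?thesis
      by (simp add: set_xs msc_recv_events_iff msc_send_events_iff)
  qed
  have dom_f: "dom f = msc_recv_events ws" and inj_f: "inj_on f (dom f)"
    using M by (auto simp: mscs_def)
  \<comment> \<open>\<open>pos\<close> sends an event to its index in \<open>xs\<close>; below,
    \<open>src\<close> is \<open>f\<close> transported to positions along it.\<close>
  define pos where "pos = inv_into {..<?n} ((!) xs)"
  have pos: "pos (xs ! i) = i" if "i < ?n" for i
    using that numbered_distinct[OF num] unfolding pos_def
    by (intro inv_into_f_f) (auto simp: inj_on_def nth_eq_iff_index_eq)
  have pos': "pos x < ?n \<and> xs ! pos x = x" if "x \<in> set xs" for x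
    using that pos by (metis in_set_conv_nth)
  define src where "src r = (if r < ?n then map_option pos (f (xs ! r)) else None)" for r
  have src: "\<exists>y. r < ?n \<and> s < r \<and> f (xs ! r) = Some y \<and> xs ! s = y" if "src r = Some s" for r s
  proof -
    from that obtain y where y: "r < ?n" "f (xs ! r) = Some y" "s = pos y"
      by (auto simp: src_def split: if_splits)
    then have "y \<in> set (take r xs)"
      using causal unfolding causal_def by blast
    then obtain i where "i < r" "y = xs ! i"
      by (auto simp: in_set_conv_nth)
    with y pos show ?thesis
      by auto
  qed
  have lab: "\<exists>p q m. ?w ! r = Recv p q m \<and> ?w ! s = Send p q m" if "src r = Some s" for r s
    using src[OF that] f by fastforce
  have "dom src = recv_events ?w"
  proof -
    have "r \<in> dom src \<longleftrightarrow> r \<in> recv_events ?w" if "r < ?n" for r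
    proof -
      have "r \<in> dom src \<longleftrightarrow> xs ! r \<in> dom f"
        using that by (auto simp: src_def)
      also have "\<dots> \<longleftrightarrow> r \<in> recv_events ?w"
        using that set_xs[of "xs ! r"] by (simp add: dom_f msc_recv_events_iff recv_events_def)
      finally show ?thesis .
    qed
    moreover have "r < ?n" if "r \<in> dom src \<or> r \<in> recv_events ?w" for r
      using that by (auto simp: src_def recv_events_def split: if_splits)
    ultimately show ?thesis
      by blast
  qed
  moreover have "ran src \<subseteq> send_events ?w"
  proof
    fix s assume "s \<in> ran src"
    then obtain r where r: "src r = Some s"
      by (auto simp: ran_def)
    then show "s \<in> send_events ?w"
      using src[OF r] lab[OF r] by (auto simp: send_events_def)
  qed
  moreover have "inj_on src (dom src)"
  proof (rule inj_onI)
    fix r r' assume "r \<in> dom src" and eq: "src r = src r'"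
    then obtain s where s: "src r = Some s" "src r' = Some s"
      by (metis domD)
    then have "r < ?n" "r' < ?n" "f (xs ! r) = Some (xs ! s)" "f (xs ! r') = Some (xs ! s)"
      using src[OF s(1)] src[OF s(2)] by auto
    then have "xs ! r = xs ! r'" "r < ?n" "r' < ?n"
      using inj_onD[OF inj_f, of "xs ! r" "xs ! r'"] by (auto dest: domI)
    then show "r = r'"
      using pos by metis
  qed
  ultimately have ex: "(?w, src) \<in> executions"
    using src lab unfolding executions_def by fast
  have "restrict_proc ?w p = ws p" for p
  proof -
    have "restrict_proc ?w p = map (label ws) (filter (\<lambda>x. fst x = p) xs)"
      using \<open>\<And>x. x \<in> set xs \<Longrightarrow> executor (label ws x) = fst x\<close>
      unfolding restrict_proc_def filter_map by (intro arg_cong2[of _ _ _ _ map] filter_cong) auto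
    also have "\<dots> = map ((!) (ws p)) (map snd (filter (\<lambda>x. fst x = p) xs))"
      by (auto simp: label_def)
    \<comment> \<open>The indices of \<open>p\<close> in \<open>xs\<close> run through 0, 1, 2, ...
      in order, so reading off their labels spells out \<open>ws p\<close>.\<close>
    also have "\<dots> = ws p"
      using num len unfolding numbered_def by (simp add: map_nth)
    finally show ?thesis .
  qed
  moreover have "f (msc_event ?w r) = map_option (msc_event ?w) (src r)" if "r < length ?w" for r
  proof (cases "f (xs ! r)")
    case (Some y)
    then have "y \<in> set xs"
      using f by blast
    then show ?thesis
      using that Some pos'[of y] ev by (simp add: src_def)
  qed (use that ev in \<open>simp add: src_def\<close>)
  ultimately have "msc (?w, src) = (ws, f)"
    using msc_eqI[OF ex M] by blast
  with ex events show thesis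
    using that by blast
qed

section \<open>Prefixes\<close>

lemma upt_split: "m \<le> n \<Longrightarrow> [0..<n] = [0..<m] @ [m..<n]"
  using upt_add_eq_append[of 0 m "n - m"] by simp

lemma msc_prefix_send_event:
  assumes "msc_prefix (ws, f) (ws', f')" and "snd x < length (ws (fst x))"
  shows "x \<in> msc_send_events ws \<longleftrightarrow> x \<in> msc_send_events ws'"
  using assms label_prefix[of ws x ws'] prefix_length_le[of "ws (fst x)" "ws' (fst x)"]
  by (auto simp: msc_prefix_def msc_send_events_iff)

lemma msc_prefix_recv_event:
  assumes "msc_prefix (ws, f) (ws', f')" and "snd x < length (ws (fst x))"
  shows "x \<in> msc_recv_events ws \<longleftrightarrow> x \<in> msc_recv_events ws'"
  using assms label_prefix[of ws x ws'] prefix_length_le[of "ws (fst x)" "ws' (fst x)"]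
  by (auto simp: msc_prefix_def msc_recv_events_iff)

text \<open>\<open>msc_prefix\<close> compares sources at receive events only. At any other event of
  the smaller MSC both source maps are undefined.\<close>

lemma msc_prefix_src:
  assumes "msc_prefix (ws, f) (ws', f')" and "(ws, f) \<in> mscs" and "(ws', f') \<in> mscs"
    and "snd x < length (ws (fst x))"
  shows "f' x = f x"
proof (cases "x \<in> msc_recv_events ws")
  case True
  then show ?thesis
    using assms(1) by (simp add: msc_prefix_def)
next
  case False
  then have "x \<notin> dom f" "x \<notin> dom f'"
    using assms msc_prefix_recv_event[OF assms(1,4)] by (auto simp: mscs_def)
  then show ?thesis
    by (metis domIff)
qed

text \<open>The new event list begins with that of \<open>w\<close> unchanged, and the appended
  events complete each process to its word in the larger MSC. The clause on \<open>synch\<close>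
  serves deadlock-freedom in the synchronous model.\<close>

lemma exec_extend:
  assumes e: "(w, src) \<in> executions" and e': "(w', src') \<in> executions"
    and pre: "msc_prefix (msc (w, src)) (msc (w', src'))"
  obtains e'' where "e'' \<in> executions" "exec_prefix (w, src) e''" "msc e'' = msc (w', src')"
    "(w, src) \<in> synch \<Longrightarrow> (w', src') \<in> synch \<Longrightarrow> e'' \<in> synch"
proof -
  define ws f ws' f' where "ws = restrict_proc w" and "f = snd (msc (w, src))"
    and "ws' = restrict_proc w'" and "f' = snd (msc (w', src'))"
  note defs = ws_def f_def ws'_def f'_def
  have M: "msc (w, src) = (ws, f)" and M': "msc (w', src') = (ws', f')"
    by (simp_all add: defs prod_eq_iff)
  have in_M: "(ws, f) \<in> mscs" and in_M': "(ws', f') \<in> mscs"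
    using msc_in_mscs[OF e] msc_in_mscs[OF e'] by (simp_all add: M M')
  have pre': "msc_prefix (ws, f) (ws', f')"
    using pre by (simp add: M M')
  have len_le: "length (ws p) \<le> length (ws' p)" for p
    using pre' by (simp add: msc_prefix_def prefix_length_le)
  let ?P = "\<lambda>x. x \<notin> set (msc_events w)"
  let ?xs = "msc_events w @ filter ?P (msc_events w')"
  have set: "x \<in> set (msc_events w) \<longleftrightarrow> snd x < length (ws (fst x))" for x
    using in_set_msc_events[of "fst x" "snd x" w] by (simp add: ws_def)
  have f_eq: "f' x = f x" if "x \<in> set (msc_events w)" for x
    using that msc_prefix_src[OF pre' in_M in_M'] by (simp add: set)
  \<comment> \<open>On each process \<open>w\<close> provides the indices below
    \<open>length (ws p)\<close>, and the surviving events of \<open>w'\<close> continue from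
    there.\<close>
  have snd_filter: "map snd (filter (\<lambda>x. fst x = p) ?xs) = [0..<length (ws' p)]" for p
  proof -
    have "filter (\<lambda>x. fst x = p) (filter ?P (msc_events w'))
        = filter (\<lambda>x. \<not> snd x < length (ws p)) (filter (\<lambda>x. fst x = p) (msc_events w'))"
      by (auto simp: set conj_commute intro!: filter_cong)
    then have "map snd (filter (\<lambda>x. fst x = p) (filter ?P (msc_events w')))
        = filter (\<lambda>i. \<not> i < length (ws p)) (map snd (filter (\<lambda>x. fst x = p) (msc_events w')))"
      by (simp add: filter_map comp_def)
    also have "\<dots> = filter (\<lambda>i. \<not> i < length (ws p)) ([0..<length (ws p)] @ [length (ws p)..<length (ws' p)])"
      using numbered_msc_events[of w'] upt_split[OF len_le, of p]
      by (simp add: numbered_def length_filter_msc_events ws'_def)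
    also have "\<dots> = [length (ws p)..<length (ws' p)]"
      by (simp add: filter_empty_conv)
    finally have "map snd (filter (\<lambda>x. fst x = p) ?xs)
        = [0..<length (ws p)] @ [length (ws p)..<length (ws' p)]"
      using numbered_msc_events[of w] by (simp add: numbered_def length_filter_msc_events ws_def)
    then show ?thesis
      using upt_split[OF len_le, of p] by simp
  qed
  have len: "length (filter (\<lambda>x. fst x = p) ?xs) = length (ws' p)" for p
    using arg_cong[OF snd_filter, of length p] by (simp only: length_map length_upt diff_zero)
  have num: "numbered ?xs"
    unfolding numbered_def len snd_filter by simp
  have causal_w: "causal f' (msc_events w)"
    using causal_msc_events[OF e] f_eq nth_mem unfolding causal_def f_def[symmetric] by metis
  then have "causal f' ?xs"
    using causal_msc_events[OF e'] unfolding f'_def[symmetric] by (rule causal_append_filter)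
  from realise_event_list[OF in_M' num len this]
  obtain src'' where e'': "(map (label ws') ?xs, src'') \<in> executions"
    "msc (map (label ws') ?xs, src'') = (ws', f')" "msc_events (map (label ws') ?xs) = ?xs" .
  \<comment> \<open>The labels of the larger MSC extend those of the smaller one, so the first block
    still spells \<open>w\<close>.\<close>
  have "map (label ws') (msc_events w) = map (label ws) (msc_events w)"
  proof (rule map_cong[OF refl])
    fix x assume "x \<in> set (msc_events w)"
    then show "label ws' x = label ws x"
      using pre' by (intro label_prefix) (auto simp: set msc_prefix_def)
  qed
  then have "map (label ws') (msc_events w) = w"
    by (simp add: ws_def map_label_msc_events)
  then have "prefix w (map (label ws') ?xs)"
    by simp
  then have "exec_prefix (w, src) (map (label ws') ?xs, src'')"
    using exec_prefix_iff_msc_prefix[OF e e''(1)] pre' by (simp only: M e''(2))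
  moreover have "(map (label ws') ?xs, src'') \<in> synch"
    if "(w, src) \<in> synch" and "(w', src') \<in> synch"
  proof -
    have "restrict_proc (map (label ws') ?xs) = ws'"
      using e''(2) by (metis fst_msc fst_conv)
    moreover have "synched f' (msc_send_events ws') ?xs"
    proof (rule synched_append)
      have "synched f (msc_send_events ws) (msc_events w)"
        using that(1) synch_iff_synched[OF e] by (simp add: defs)
      then show "synched f' (msc_send_events ws') (msc_events w)"
        using f_eq msc_prefix_send_event[OF pre']
        by (auto simp: synched_iff set_msc_events simp flip: set)
    next
      have "synched f' (msc_send_events ws') (msc_events w')"
        using that(2) synch_iff_synched[OF e'] by (simp add: defs)
      then show "synched f' (msc_send_events ws') (filter ?P (msc_events w'))"
      proof (rule synched_filter)
        fix x y assume x: "?P x" and y: "f' y = Some x"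
        \<comment> \<open>A receive in \<open>w\<close> has its source in \<open>w\<close>; hence a
          receive whose send is outside \<open>w\<close> is outside \<open>w\<close> too.\<close>
        have "?P y"
        proof
          assume "y \<in> set (msc_events w)"
          then have "f y = Some x"
            using f_eq y by simp
          then have "x \<in> msc_send_events ws"
            using in_M ranI[of f y x] by (auto simp: mscs_def)
          with x show False
            by (simp add: set msc_send_events_iff)
        qed
        with y show "?P y \<and> f' y = Some x"
          by simp
      qed
    qed
    ultimately show ?thesis
      using synch_iff_synched[OF e''(1)] unfolding e''(2,3) by simp
  qed
  ultimately show thesis
    using that e'' M' by simp
qed

text \<open>Deletion could break synchrony only where a kept send loses its receive, and
  orphan-freedom excludes this. Sources of kept receives are kept because the smaller MSC contains
  them.\<close>

lemma orphan_free_prefix_synch: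
  assumes e: "(w, src) \<in> executions" and e': "(w', src') \<in> synch"
    and pre: "msc_prefix (msc (w, src)) (msc (w', src'))"
    and orphan_free: "orphan_free (w, src)"
  obtains e'' where "e'' \<in> synch" "msc e'' = msc (w, src)"
proof -
  have ex': "(w', src') \<in> executions"
    using e' by (simp add: synch_def)
  define ws f ws' f' where "ws = restrict_proc w" and "f = snd (msc (w, src))"
    and "ws' = restrict_proc w'" and "f' = snd (msc (w', src'))"
  note defs = ws_def f_def ws'_def f'_def
  have M: "msc (w, src) = (ws, f)" and M': "msc (w', src') = (ws', f')"
    by (simp_all add: defs prod_eq_iff)
  have in_M: "(ws, f) \<in> mscs" and in_M': "(ws', f') \<in> mscs"
    using msc_in_mscs[OF e] msc_in_mscs[OF ex'] by (simp_all add: M M')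
  have pre': "msc_prefix (ws, f) (ws', f')"
    using pre by (simp add: M M')
  have len_le: "length (ws p) \<le> length (ws' p)" for p
    using pre' by (simp add: msc_prefix_def prefix_length_le)
  let ?P = "\<lambda>x. snd x < length (ws (fst x))"
  let ?xs = "filter ?P (msc_events w')"
  have f_eq: "f' x = f x" if "?P x" for x
    using that msc_prefix_src[OF pre' in_M in_M'] by simp
  have P_f: "?P x \<and> ?P y" if "f x = Some y" for x y
  proof -
    have "x \<in> msc_recv_events ws" "y \<in> msc_send_events ws"
      using in_M domI[of f, OF that] ranI[of f, OF that] by (auto simp: mscs_def)
    then show ?thesis
      by (simp add: msc_recv_events_iff msc_send_events_iff)
  qed
  \<comment> \<open>At each process the deletion leaves an initial segment of its events, so no
    event has to be renumbered.\<close>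
  have snd_filter: "map snd (filter (\<lambda>x. fst x = p) ?xs) = [0..<length (ws p)]" for p
  proof -
    have "filter (\<lambda>x. fst x = p) ?xs
        = filter (\<lambda>x. snd x < length (ws p)) (filter (\<lambda>x. fst x = p) (msc_events w'))"
      by (auto intro!: filter_cong)
    then have "map snd (filter (\<lambda>x. fst x = p) ?xs)
        = filter (\<lambda>i. i < length (ws p)) (map snd (filter (\<lambda>x. fst x = p) (msc_events w')))"
      by (simp add: filter_map comp_def)
    also have "\<dots> = filter (\<lambda>i. i < length (ws p)) ([0..<length (ws p)] @ [length (ws p)..<length (ws' p)])"
      using numbered_msc_events[of w'] upt_split[OF len_le, of p]
      by (simp add: numbered_def length_filter_msc_events ws'_def)
    also have "\<dots> = [0..<length (ws p)]"
      by (simp add: filter_empty_conv)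
    finally show ?thesis .
  qed
  have len: "length (filter (\<lambda>x. fst x = p) ?xs) = length (ws p)" for p
    using arg_cong[OF snd_filter, of length p] by (simp only: length_map length_upt diff_zero)
  have num: "numbered ?xs"
    unfolding numbered_def len snd_filter by simp
  have "causal f ?xs"
    using causal_msc_events[OF ex'] unfolding f'_def[symmetric]
    by (rule causal_filter) (use f_eq P_f in auto)
  from realise_event_list[OF in_M num len this]
  obtain src'' where e'': "(map (label ws) ?xs, src'') \<in> executions"
    "msc (map (label ws) ?xs, src'') = (ws, f)" "msc_events (map (label ws) ?xs) = ?xs" .
  have "restrict_proc (map (label ws) ?xs) = ws"
    using e''(2) by (metis fst_msc fst_conv)
  moreover have "synched f (msc_send_events ws) ?xs"
  proof (rule synched_filter)
    show "synched f' (msc_send_events ws') (msc_events w')"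
      using e' synch_iff_synched[OF ex'] by (simp add: defs)
  next
    fix x assume "x \<in> msc_send_events ws" "?P x"
    then show "x \<in> msc_send_events ws'"
      using msc_prefix_send_event[OF pre'] by blast
  next
    fix x y assume x: "?P x" "x \<in> msc_send_events ws'" and y: "f' y = Some x"
    then have "x \<in> msc_send_events ws"
      using msc_prefix_send_event[OF pre'] by blast
    \<comment> \<open>Orphan-freedom supplies a receive \<open>z\<close> of \<open>x\<close> in the
      smaller MSC. As \<open>f'\<close> is injective, \<open>z\<close> is \<open>y\<close>, which is
      therefore kept.\<close>
    then obtain z where z: "f z = Some x"
      using orphan_free orphan_free_iff_msc[OF e] by (auto simp: defs ran_def)
    then have "f' z = Some x"
      using f_eq P_f by simp
    then have "z = y"
      using y in_M' inj_onD[of f' "dom f'" z y] domI[of f'] by (auto simp: mscs_def)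
    with z show "?P y \<and> f y = Some x"
      using P_f by blast
  qed
  ultimately have "(map (label ws) ?xs, src'') \<in> synch"
    using synch_iff_synched[OF e''(1)] unfolding e''(2,3) by simp
  then show thesis
    using that e''(2) M by simp
qed

section \<open>Global types\<close>

lemma synch_orphan_free: "e \<in> synch \<Longrightarrow> orphan_free e"
  by (cases e) (fastforce simp: synch_def executions_def orphan_free_def ran_def)

lemma arrows_exec_Cons:
  "fst (arrows_exec ((p, q, m) # u)) = Send p q m # Recv p q m # fst (arrows_exec u)"
  by (simp add: arrows_exec_def)

lemma arrows_exec_word:
  "length (fst (arrows_exec u)) = 2 * length u \<and>
   (\<forall>i < length u. \<exists>p q m. fst (arrows_exec u) ! (2 * i) = Send p q m \<and>
      fst (arrows_exec u) ! Suc (2 * i) = Recv p q m)"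
proof (induction u)
  case Nil
  then show ?case
    by (simp add: arrows_exec_def)
next
  case (Cons a u)
  obtain p q m where a: "a = (p, q, m)"
    by (cases a)
  show ?case
    using Cons by (auto simp: a arrows_exec_Cons All_less_Suc2)
qed

text \<open>Counting from 0, arrow number \<open>k\<close> occupies positions \<open>2 * k\<close>
  and \<open>Suc (2 * k)\<close>, so parity separates sends from receives and each source is one
  position to the left.\<close>

lemma arrows_exec_synch: "arrows_exec u \<in> synch"
proof -
  define w where "w = fst (arrows_exec u)"
  define src where "src i = (if i < 2 * length u \<and> odd i then Some (i - 1) else None)" for i :: nat
  have eq: "arrows_exec u = (w, src)"
    by (simp add: w_def src_def[abs_def] arrows_exec_def)
  have len: "length w = 2 * length u"
    using arrows_exec_word[of u] by (simp add: w_def)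
  have arrow: "\<exists>p q m. w ! (2 * i) = Send p q m \<and> w ! Suc (2 * i) = Recv p q m"
    if "i < length u" for i
    using that arrows_exec_word[of u] by (simp add: w_def)
  have send: "send_events w = {i. i < 2 * length u \<and> even i}"
    and recv: "recv_events w = {i. i < 2 * length u \<and> odd i}"
  proof -
    have "is_send (w ! i) = even i \<and> is_recv (w ! i) = odd i" if "i < 2 * length u" for i
    proof (cases "even i")
      case True
      then obtain k where "i = 2 * k" by blast
      then show ?thesis
        using arrow[of k] that by auto
    next
      case False
      then obtain k where "i = Suc (2 * k)"
        by (metis oddE Suc_eq_plus1)
      then show ?thesis
        using arrow[of k] that by auto
    qed
    then show "send_events w = {i. i < 2 * length u \<and> even i}"
      "recv_events w = {i. i < 2 * length u \<and> odd i}"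
      unfolding send_events_def recv_events_def len by blast+
  qed
  have src: "\<exists>k < length u. r = Suc (2 * k) \<and> s = 2 * k" if "src r = Some s" for r s
    using that unfolding src_def by (auto split: if_splits elim!: oddE)
  have "dom src = recv_events w"
    by (auto simp: recv src_def split: if_splits)
  moreover have "ran src \<subseteq> send_events w"
    using src by (fastforce simp: send ran_def)
  moreover have "inj_on src (dom src)"
  proof (rule inj_onI)
    fix r r' assume "r \<in> dom src" and eq: "src r = src r'"
    then obtain s where s: "src r = Some s" "src r' = Some s"
      by (metis domD)
    show "r = r'"
      using src[OF s(1)] src[OF s(2)] by auto
  qed
  moreover have "s < r \<and> (\<exists>p q m. w ! r = Recv p q m \<and> w ! s = Send p q m)"
    if "src r = Some s" for r s
    using src[OF that] arrow by fastforce
  ultimately have "(w, src) \<in> executions"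
    unfolding executions_def by blast
  moreover have "Suc s \<in> recv_events w \<and> src (Suc s) = Some s" if "s \<in> send_events w" for s
    using that by (auto simp: send recv src_def elim!: evenE)
  ultimately show ?thesis
    by (simp add: eq synch_def)
qed

text \<open>At each step \<open>p\<close> performs what the arrow contributes to it, or an
  epsilon-step if it is not involved. One run of \<open>G\<close> thus gives runs of all projections
  through the same states.\<close>

lemma run_proj:
  assumes "run G s u t" and "transitions G \<subseteq> states G \<times> insert None (Some ` Arr) \<times> states G"
    and "\<And>s t. (s, None, t) \<notin> transitions G"
  shows "run (proj G p) s (restrict_proc (fst (arrows_exec u)) p) t"
  using assms(1)
proof induction
  case (run_Nil s)
  show ?case
    by (simp add: arrows_exec_def restrict_proc_def run.run_Nil)
next
  case (run_eps s t w u)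
  with assms(3) show ?case
    by blast
next
  case (run_Cons s a t w u)
  obtain q r m where a: "a = (q, r, m)"
    by (cases a)
  \<comment> \<open>With equal endpoints the word could give \<open>p\<close> two actions where
    \<open>proj_arrow\<close> yields only the send.\<close>
  have "q \<noteq> r"
    using run_Cons.hyps(1) assms(2) by (auto simp: a Arr_def)
  moreover have "(s, proj_arrow p a, t) \<in> transitions (proj G p)"
    using run_Cons.hyps(1) unfolding proj_def nfa.simps by blast
  ultimately show ?case
    using run_Cons.IH
    by (auto simp: a arrows_exec_Cons restrict_proc_def intro: run.intros split: if_splits)
qed

lemma restrict_proc_arrows_exec:
  assumes "global_type G" and "u \<in> language G"
  shows "restrict_proc (fst (arrows_exec u)) p \<in> language (proj G p)"
proof -
  obtain t where "t \<in> accepting G" "run G (initial G) u t"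
    using assms(2) by (auto simp: language_def)
  moreover have "run (proj G p) (initial G) (restrict_proc (fst (arrows_exec u)) p) t"
    using assms(1) run_proj[OF \<open>run G (initial G) u t\<close>]
    by (simp add: global_type_def dfa_over_def nfa_over_def)
  moreover have "accepting (proj G p) = accepting G" "initial (proj G p) = initial G"
    by (simp_all add: proj_def)
  ultimately show ?thesis
    by (auto simp: language_def)
qed

section \<open>Acceptance depends only on the MSC\<close>

lemma restrict_proc_eq_of_msc_eq: "msc e = msc e' \<Longrightarrow> restrict_proc (fst e) = restrict_proc (fst e')"
  by (metis fst_msc prod.collapse)

text \<open>This half of (CC) holds for any set \<open>com\<close>: an accepting run on
  \<open>u\<close> yields accepting runs of all projections, and executions with the same MSC have
  the same restrictions.\<close>

lemma Exec_gt_subset_Exec_sys_proj: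
  assumes "global_type G"
  shows "Exec_gt G com \<subseteq> Exec_sys (proj G) com"
proof
  fix e assume "e \<in> Exec_gt G com"
  then obtain u where u: "u \<in> language G" "msc e = msc (arrows_exec u)" "e \<in> com"
    by (auto simp: Exec_gt_def L_exists_def arrows_msc_def Lin_com_def Lin_def)
  then show "e \<in> Exec_sys (proj G) com"
    using restrict_proc_arrows_exec[OF assms u(1)] restrict_proc_eq_of_msc_eq[OF u(2)]
    by (simp add: Exec_sys_def)
qed

lemma Exec_gt_iff:
  "e \<in> Exec_gt G com \<longleftrightarrow> e \<in> executions \<and> e \<in> com \<and> msc e \<in> L_exists G"
  by (auto simp: Exec_gt_def Lin_com_def Lin_def)

text \<open>A system sees only the restrictions to processes. With two models in the statement,
  acceptance can be carried between \<open>com\<close> and \<open>synch\<close>.\<close>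

lemma Exec_sys_msc_cong:
  "e \<in> Exec_sys S com \<Longrightarrow> msc e' = msc e \<Longrightarrow> e' \<in> com' \<Longrightarrow> e' \<in> Exec_sys S com'"
  using restrict_proc_eq_of_msc_eq[of e' e] by (simp add: Exec_sys_def)

text \<open>Condition 3 makes all states accepting before projecting, deadlock-freedom does so
  afterwards; projection copies the state set, so the results agree.\<close>

lemma proj_all_accepting: "proj (all_accepting G) = system_acc (proj G)"
  by (simp add: proj_def all_accepting_def system_acc_def)

lemma msc_prefix_refl: "msc_prefix M M"
  by (simp add: msc_prefix_def)

section \<open>Realisability in a causally closed model\<close>

theorem theorem5p6:
  fixes com :: "('p::finite, 'm::finite) execution set"
    and G :: "('s, ('p, 'm) arrow) nfa"
  assumes "communication_model com"
    and "causally_closed com"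
    and "synch \<subseteq> com"
    and "global_type G"
  shows "deadlock_free_realisable G com \<longleftrightarrow>
      MSC_sys (proj G) com \<subseteq> Pref (MSC_com synch) \<and>
      orphan_free_in (proj G) com \<and>
      MSC_sys (proj (all_accepting G)) com \<subseteq> Pref (MSC_sys (proj G) com) \<and>
      deadlock_free_realisable G synch"
proof (intro iffI conjI)
  have com: "e \<in> executions" if "e \<in> com" for e
    using assms(1) that by (auto simp: communication_model_def)
  have sys_com: "e \<in> com" if "e \<in> Exec_sys S com" for e and S :: "('s, 'p, 'm) system"
    using that by (simp add: Exec_sys_def)
  have msc_mscs: "msc e \<in> mscs" if "e \<in> com" for e
    using com[OF that] msc_in_mscs by (cases e) blast
  {
    assume dfr: "deadlock_free_realisable G com"
    then have CC: "Exec_sys (proj G) com = Exec_gt G com"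
      and DF: "deadlock_free_in (proj G) com"
      by (simp_all add: deadlock_free_realisable_def)
    \<comment> \<open>By (CC) the MSC of every such execution is that of an arrow word, so it has a
      synchronous linearisation.\<close>
    have arrows: "\<exists>u. u \<in> language G \<and> msc e = msc (arrows_exec u)"
      if "e \<in> Exec_sys (proj G) com" for e
      using that by (auto simp: CC Exec_gt_iff L_exists_def arrows_msc_def)
    show "MSC_sys (proj G) com \<subseteq> Pref (MSC_com synch)"
    proof
      fix M assume "M \<in> MSC_sys (proj G) com"
      then obtain e where e: "e \<in> Exec_sys (proj G) com" "M = msc e"
        by (auto simp: MSC_sys_def)
      then have "M \<in> MSC_com synch" "M \<in> mscs"
        using arrows[OF e(1)] arrows_exec_synch msc_mscs[OF sys_com] by (auto simp: MSC_com_def)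
      then show "M \<in> Pref (MSC_com synch)"
        using msc_prefix_refl[of M] by (auto simp: Pref_def)
    qed
    show "orphan_free_in (proj G) com"
      unfolding orphan_free_in_def
    proof
      fix e assume e: "e \<in> Exec_sys (proj G) com"
      obtain u where u: "msc e = msc (arrows_exec u)"
        using arrows[OF e] by blast
      obtain w src w' src' where [simp]: "e = (w, src)" "arrows_exec u = (w', src')"
        by fastforce
      have "(w, src) \<in> executions" "(w', src') \<in> synch" "(w', src') \<in> executions"
        using com[OF sys_com[OF e]] arrows_exec_synch[of u] by (simp_all add: synch_def)
      \<comment> \<open>The arrow word is synchronous and so has no orphans; this is read off the
        common MSC.\<close>
      then show "orphan_free e"
        using u restrict_proc_eq_of_msc_eq[OF u] synch_orphan_free[of "(w', src')"]
        by (simp add: orphan_free_iff_msc)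
    qed
    show "MSC_sys (proj (all_accepting G)) com \<subseteq> Pref (MSC_sys (proj G) com)"
    proof
      fix M assume "M \<in> MSC_sys (proj (all_accepting G)) com"
      then obtain e where e: "e \<in> Exec_sys (system_acc (proj G)) com" "M = msc e"
        by (auto simp: MSC_sys_def proj_all_accepting)
      then obtain e' where e': "e' \<in> Exec_sys (proj G) com" "exec_prefix e e'"
        using DF by (auto simp: deadlock_free_in_def)
      obtain w src w' src' where [simp]: "e = (w, src)" "e' = (w', src')"
        by fastforce
      have "msc_prefix (msc e) (msc e')"
        using exec_prefix_iff_msc_prefix[of w src w' src'] e'(2) com[OF sys_com[OF e(1)]]
          com[OF sys_com[OF e'(1)]] by (simp add: exec_prefix_def)
      then show "M \<in> Pref (MSC_sys (proj G) com)"
        using e e' msc_mscs[OF sys_com[OF e(1)]] unfolding Pref_def MSC_sys_def by blast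
    qed
    \<comment> \<open>(CC) for \<open>synch\<close> is (CC) for \<open>com\<close> with both sides
      intersected with \<open>synch\<close>.\<close>
    have "Exec_sys (proj G) synch = Exec_gt G synch"
    proof -
      have "Exec_sys (proj G) synch = Exec_sys (proj G) com \<inter> synch"
        using assms(3) by (auto simp: Exec_sys_def)
      moreover have "Exec_gt G synch = Exec_gt G com \<inter> synch"
        using assms(3) by (auto simp: Exec_gt_iff)
      ultimately show ?thesis
        by (simp add: CC)
    qed
    \<comment> \<open>The extension \<open>e'\<close> obtained in \<open>com\<close> need not be
      synchronous, so it is replaced by the arrow word with the same MSC. Then
      \<open>exec_extend\<close> has two synchronous inputs and yields a synchronous extension of
      \<open>e\<close>.\<close>
    moreover have "deadlock_free_in (proj G) synch"
      unfolding deadlock_free_in_def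
    proof
      fix e assume e: "e \<in> Exec_sys (system_acc (proj G)) synch"
      then have "e \<in> Exec_sys (system_acc (proj G)) com"
        using assms(3) by (auto simp: Exec_sys_def)
      then obtain e' where e': "e' \<in> Exec_sys (proj G) com" "exec_prefix e e'"
        using DF by (auto simp: deadlock_free_in_def)
      obtain u where u: "msc e' = msc (arrows_exec u)"
        using arrows[OF e'(1)] by blast
      obtain w src w' src' v vsrc where [simp]: "e = (w, src)" "e' = (w', src')"
        "arrows_exec u = (v, vsrc)"
        by (metis prod.exhaust)
      have syn: "(w, src) \<in> synch" "(v, vsrc) \<in> synch"
        using e arrows_exec_synch[of u] by (simp_all add: Exec_sys_def)
      then have ex: "(w, src) \<in> executions" "(v, vsrc) \<in> executions"
        by (simp_all add: synch_def)
      have "msc_prefix (msc (w, src)) (msc (v, vsrc))"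
        using exec_prefix_iff_msc_prefix[of w src w' src'] e'(2) ex(1) u
          com[OF sys_com[OF e'(1)]] by (simp add: exec_prefix_def)
      from exec_extend[OF ex this] obtain e'' where
        "exec_prefix (w, src) e''" "msc e'' = msc (v, vsrc)" "e'' \<in> synch"
        using syn by metis
      then show "\<exists>e' \<in> Exec_sys (proj G) synch. exec_prefix e e'"
        using Exec_sys_msc_cong[OF e'(1), of e'' synch] u by auto
    qed
    ultimately show "deadlock_free_realisable G synch"
      by (simp add: deadlock_free_realisable_def)
  next
    assume "MSC_sys (proj G) com \<subseteq> Pref (MSC_com synch) \<and>
      orphan_free_in (proj G) com \<and>
      MSC_sys (proj (all_accepting G)) com \<subseteq> Pref (MSC_sys (proj G) com) \<and>
      deadlock_free_realisable G synch"
    then have pref_synch: "MSC_sys (proj G) com \<subseteq> Pref (MSC_com synch)"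
      and orphan: "orphan_free_in (proj G) com"
      and pref_acc: "MSC_sys (system_acc (proj G)) com \<subseteq> Pref (MSC_sys (proj G) com)"
      and CC: "Exec_sys (proj G) synch = Exec_gt G synch"
      by (simp_all add: deadlock_free_realisable_def proj_all_accepting)
    have "Exec_sys (proj G) com \<subseteq> Exec_gt G com"
    proof
      fix e assume e: "e \<in> Exec_sys (proj G) com"
      then have "msc e \<in> Pref (MSC_com synch)"
        using pref_synch by (auto simp: MSC_sys_def)
      then obtain e' where e': "e' \<in> synch" "msc_prefix (msc e) (msc e')"
        by (auto simp: Pref_def MSC_com_def)
      obtain w src w' src' where [simp]: "e = (w, src)" "e' = (w', src')"
        by fastforce
      \<comment> \<open>Condition 1 bounds the MSC of \<open>e\<close> by a synchronous one, and
        orphan-freedom allows cutting this down to exactly the MSC of \<open>e\<close>.\<close>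
      obtain e'' where "e'' \<in> synch" "msc e'' = msc e"
        using orphan_free_prefix_synch[of w src w' src'] e' e orphan com[OF sys_com[OF e]]
        by (auto simp: orphan_free_in_def)
      \<comment> \<open>The synchronous linearisation is accepted by the projections as well, so
        (CC) for \<open>synch\<close> finds an arrow word with this MSC.\<close>
      then have "msc e \<in> L_exists G"
        using Exec_sys_msc_cong[OF e, of e'' synch] by (simp add: CC Exec_gt_iff)
      then show "e \<in> Exec_gt G com"
        using com[OF sys_com[OF e]] sys_com[OF e] by (simp add: Exec_gt_iff)
    qed
    moreover have "deadlock_free_in (proj G) com"
      unfolding deadlock_free_in_def
    proof
      fix e assume e: "e \<in> Exec_sys (system_acc (proj G)) com"
      then obtain e' where e': "e' \<in> Exec_sys (proj G) com" "msc_prefix (msc e) (msc e')"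
        using pref_acc by (fastforce simp: MSC_sys_def Pref_def)
      obtain w src w' src' where [simp]: "e = (w, src)" "e' = (w', src')"
        by fastforce
      have "(w, src) \<in> executions" "(w', src') \<in> executions"
        "msc_prefix (msc (w, src)) (msc (w', src'))"
        using e'(2) com[OF sys_com[OF e]] com[OF sys_com[OF e'(1)]] by simp_all
      \<comment> \<open>Condition 3 gives a prefix relation between MSCs only, so \<open>e'\<close>
        is reordered to begin with \<open>e\<close>.\<close>
      from exec_extend[OF this] obtain e'' where
        e'': "e'' \<in> executions" "exec_prefix e e''" "msc e'' = msc e'"
        by (metis \<open>e = (w, src)\<close> \<open>e' = (w', src')\<close>)
      \<comment> \<open>One linearisation of this MSC lies in \<open>com\<close>, so by causal
        closure all do, including the reordered one.\<close>
      have "e' \<in> Lin_com com (msc e')"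
        using sys_com[OF e'(1)] com by (simp add: Lin_com_def Lin_def)
      then have "Lin_com com (msc e') = Lin (msc e')"
        using assms(2) msc_mscs[OF sys_com[OF e'(1)]] unfolding causally_closed_def by blast
      then have "e'' \<in> com"
        using e'' by (auto simp: Lin_com_def Lin_def)
      then show "\<exists>e' \<in> Exec_sys (proj G) com. exec_prefix e e'"
        using Exec_sys_msc_cong[OF e'(1) e''(3)] e''(2) by blast
    qed
    ultimately show "deadlock_free_realisable G com"
      using Exec_gt_subset_Exec_sys_proj[OF assms(4)] by (auto simp: deadlock_free_realisable_def)
  }
qed

end
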